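(* Let $z^\star=(\tilde X^\star,U^\star,S^\star)\in\mathbb{R}^{n_z}$ and assume that the closed convex set $\mathcal Z$ and the point $z^\star$ satisfy the following regularity assumptions: $\mathcal Z=\mathcal C\cap\mathcal D$ with $\mathcal C=\{z\in\mathbb{R}^{n_z}\mid\check\Omega_i(z)\le0,\ i=1,\dots,N_{\mathcal C}\}$, $\check\Omega_i$ continuously differentiable convex functions, and $\mathcal D=\{z\in\mathbb{R}^{n_z}\mid a_j^\top z+b_j=0,\ j=1,\dots,N_{\mathcal D}\}$, $a_j\in\mathbb{R}^{n_z}$, $b_j\in\mathbb{R}$, where (i) the vectors $\nabla\check\Omega_i(z^\star)$ for $i\in I_{\mathcal C}(z^\star)=\{i\mid\check\Omega_i(z^\star)=0\}$, together with $a_j$, $j=1,\dots,N_{\mathcal D}$, are linearly independent, and (ii) the intersection of $\mathcal D$ with the interior of $\mathcal C$ is nonempty. If $z^\star$ is a stationary point of $\Theta_\gamma$ (for a given $\gamma>0$) and $z^\star$ is feasible with respect to the problem (OCP$_\epsilon$), then $z^\star$ is a KKT point of (OCP$_\epsilon$). Conversely, if $z^\star$ is a KKT point of (OCP$_\epsilon$) and $\gamma$ is sufficiently large, then $z^\star$ is also a stationary point of $\Theta_\gamma$.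
   Context: $\mathbb{R}_+$: nonnegative reals; $|w|_+=\max\{0,w\}$, applied elementwise to vectors; $\tilde I_{\mathcal Z}$: indicator function of $\mathcal Z$ ($0$ on $\mathcal Z$, $+\infty$ off $\mathcal Z$); $\mathcal N_{\mathcal Z}(z)$: normal cone of the convex set $\mathcal Z$ at $z$ (empty if $z\notin\mathcal Z$). Gradients of scalar functions are row vectors where multiplied with multipliers below. Data: $f:\mathbb{R}_+\times\mathbb{R}^{n_x}\times\mathbb{R}^{n_u}\to\mathbb{R}^{n_x}$, $g:\mathbb{R}_+\times\mathbb{R}^{n_x}\times\mathbb{R}^{n_u}\to\mathbb{R}^{n_g}$, $h:\mathbb{R}_+\times\mathbb{R}^{n_x}\times\mathbb{R}^{n_u}\to\mathbb{R}^{n_h}$, $L:\mathbb{R}_+\times\mathbb{R}^{n_x}\to\mathbb{R}$, $P:\mathbb{R}_+\times\mathbb{R}^{n_x}\times\mathbb{R}_+\times\mathbb{R}^{n_x}\to\mathbb{R}^{n_P}$, $Q:\mathbb{R}_+\times\mathbb{R}^{n_x}\times\mathbb{R}_+\times\mathbb{R}^{n_x}\to\mathbb{R}^{n_Q}$ are continuously differentiable; $t_{\mathrm i}\ge0$ and $\epsilon>0$ are fixed. For any compact $\mathbb{U}\subset\mathbb{R}^{n_u}$ and $t_{\mathrm f}>t_{\mathrm i}$ there are positive $\vartheta,\varrho$ with $\|f(t,x,u)\|\le\vartheta\|x\|+\varrho$ on $[t_{\mathrm i},t_{\mathrm f}]\times\mathbb{R}^{n_x}\times\mathbb{U}$. Penalty: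 $q_i,p_j:\mathbb{R}\to\mathbb{R}_+$ are continuously differentiable, $q_i(z)=0$ iff $z\le0$, $p_j(z)=0$ iff $z=0$; $\Lambda(t,x,u)=\sum_{i=1}^{n_g}q_i(g_i(t,x,u))+\sum_{j=1}^{n_h}p_j(h_j(t,x,u))$. Augmented system: $\tilde x=(x,y,t)\in\mathbb{R}^{n_{\tilde x}}$, $n_{\tilde x}=n_x+2$; $\tilde u=(u,s)$; selectors $E_x\tilde x=x$, $E_y\tilde x=y$, $E_t\tilde x=t$; $F(\tilde x,\tilde u)=\big(f(t,x,u),\Lambda(t,x,u),1\big)s$. Parameterization: $\tilde\nu(\tau)=\big((\Gamma_u(\tau)\otimes I_{n_u})U,\Gamma_s(\tau)S\big)$, $\tau\in[0,1]$, with row vectors $\Gamma_u$ (length $N_u$), $\Gamma_s$ (length $N_s$) of (piecewise) polynomial basis functions, $U\in\mathbb{R}^{n_uN_u}$, $S\in\mathbb{R}^{N_s}$. Discretization: $0=\tau_1<\dots<\tau_N=1$, $\tilde X=(\tilde x_1,\dots,\tilde x_N)$, $$F_k(\tilde x_{k+1},\tilde x_k,U,S)=\tilde x_{k+1}-\tilde x_k-\int_{\tau_k}^{\tau_{k+1}}F(\tilde x^k(\tau),\tilde\nu(\tau))\mathrm d\tau,\quad k=1,\dots,N-1,$$ where $\tilde x^k$ solves $\frac{\mathrm d\tilde x^k}{\mathrm d\tau}=F(\tilde x^k,\tilde\nu)$ a.e. on $[\tau_k,\tau_{k+1}]$ with $\tilde x^k(\tau_k)=\tilde x_k$. Put $\tilde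 L(\tilde x)=L(E_t\tilde x,E_x\tilde x)$, $\tilde P(\tilde x,\tilde x')=P(E_t\tilde x,E_x\tilde x,E_t\tilde x',E_x\tilde x')$, $\tilde Q(t_{\mathrm i},\tilde x,\tilde x')=\big(Q(t_{\mathrm i},E_x\tilde x,E_t\tilde x',E_x\tilde x'),\,E_t\tilde x-t_{\mathrm i}\big)\in\mathbb{R}^{n_Q+1}$. Problem (OCP$_\epsilon$): minimize $\tilde L(\tilde x_N)$ over $z=(\tilde X,U,S)\in\mathbb{R}^{n_z}$, $n_z=n_{\tilde x}N+n_uN_u+N_s$, subject to $F_k(\tilde x_{k+1},\tilde x_k,U,S)=0$ and $E_y(\tilde x_{k+1}-\tilde x_k)\le\epsilon$ for $k=1,\dots,N-1$, $U\in\mathcal U$, $S\in\mathcal S$, $\tilde P(\tilde x_1,\tilde x_N)\le0$, $\tilde Q(t_{\mathrm i},\tilde x_1,\tilde x_N)=0$; here $\mathcal U\subset\mathbb{R}^{n_uN_u}$, $\mathcal S\subset\mathbb{R}^{N_s}$ are compact convex sets, with $\mathcal S$ ensuring that $\Gamma_s(\tau)S$ is positive. Let $\mathcal Z=\tilde{\mathcal X}\times\mathcal U\times\mathcal S$ with $\tilde{\mathcal X}=\{(\tilde x_1,\dots,\tilde x_N)\mid E_y(\tilde x_{k+1}-\tilde x_k)\le\epsilon,\ k=1,\dots,N-1\}$. Penalized function: for $\gamma>0$, $$\Theta_\gamma(z)=\tilde L(\tilde x_N)+\tilde I_{\mathcal Z}(z)+\gamma 1^\top|\tilde P(\tilde x_1,\tilde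 x_N)|_++\gamma\|\tilde Q(t_{\mathrm i},\tilde x_1,\tilde x_N)\|_1+\gamma\sum_{k=1}^{N-1}\|F_k(\tilde x_{k+1},\tilde x_k,U,S)\|_1 .$$ Stationary point: $z^\star$ is a stationary point of $\Theta_\gamma$ if $0\in\partial\Theta_\gamma(z^\star)$, i.e. there exist $\mu\in\mathcal N_{\mathcal Z}(z^\star)$ and scalars $\lambda_i^{\tilde P}\in\partial|\cdot|_+(\tilde P_i)$, $\lambda_i^{\tilde Q}\in\partial|\cdot|(\tilde Q_i)$, $\lambda_i^{F_k}\in\partial|\cdot|(F_{ki})$ (all evaluated at $z^\star$, $\partial$ of the scalar convex functions being the convex subdifferential) such that $$\nabla_z\tilde L+\mu^\top+\gamma\sum_{i=1}^{n_P}\lambda_i^{\tilde P}\nabla_z\tilde P_i+\gamma\sum_{i=1}^{n_Q+1}\lambda_i^{\tilde Q}\nabla_z\tilde Q_i+\gamma\sum_{k=1}^{N-1}\sum_{i=1}^{n_{\tilde x}}\lambda_i^{F_k}\nabla_zF_{ki}=0$$ at $z^\star$. KKT point: $z^\star$ is a KKT point of (OCP$_\epsilon$) if it is feasible and there exist $\mu\in\mathcal N_{\mathcal Z}(z^\star)$ (under the regularity assumptions equivalently: $\mu=\sum_{i\in I_{\mathcal C}(z^\star)}\kappa_i\nabla\check\Omega_i(z^\star)^\top+\sum_j\eta_ja_j$ with $\kappa_i\ge0$, $\eta_j\in\mathbb{R}$) and multipliers $\lambda^{\tilde P}_i\ge0$, $\lambda^{\tilde Q}_i\in\mathbb{R}$,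 $\lambda^{F_k}_i\in\mathbb{R}$ such that $\nabla_z\tilde L+\mu^\top+\sum_i\lambda_i^{\tilde P}\nabla_z\tilde P_i+\sum_i\lambda_i^{\tilde Q}\nabla_z\tilde Q_i+\sum_{k,i}\lambda_i^{F_k}\nabla_zF_{ki}=0$ at $z^\star$ and $\lambda_i^{\tilde P}\tilde P_i(\tilde x_1^\star,\tilde x_N^\star)=0$ for $i=1,\dots,n_P$. *)

theory Defs
  imports "HOL-Analysis.Analysis"
begin

section \<open>Calculus and convexity notions\<close>

definition C1_on :: "('a::real_normed_vector \<Rightarrow> 'b::real_normed_vector) \<Rightarrow> 'a set \<Rightarrow> bool" where
  "C1_on \<phi> A \<longleftrightarrow>
     (\<exists>\<phi>' :: 'a \<Rightarrow> 'a \<Rightarrow>\<^sub>L 'b.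
        (\<forall>x\<in>A. (\<phi> has_derivative blinfun_apply (\<phi>' x)) (at x within A)) \<and> continuous_on A \<phi>')"

text \<open>Gradients are column vectors here. The set \<open>A\<close> is the domain of \<open>\<phi>\<close>, so that one-sided
  derivatives are taken at boundary points of the domain.\<close>

definition gradient_within :: "('a::euclidean_space \<Rightarrow> real) \<Rightarrow> 'a set \<Rightarrow> 'a \<Rightarrow> 'a" where
  "gradient_within \<phi> A z = (SOME v. (\<phi> has_derivative (\<lambda>h. v \<bullet> h)) (at z within A))"

definition normal_cone :: "'a::real_inner set \<Rightarrow> 'a \<Rightarrow> 'a set" where
  "normal_cone Z z = (if z \<in> Z then {v. \<forall>y\<in>Z. v \<bullet> (y - z) \<le> 0} else {})"

definition subdifferential :: "(real \<Rightarrow> real) \<Rightarrow> real \<Rightarrow> real set" where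
  "subdifferential \<phi> w = {v. \<forall>y. \<phi> y \<ge> \<phi> w + v * (y - w)}"

definition pos_part :: "real \<Rightarrow> real" where
  "pos_part w = max 0 w"

definition absolutely_continuous_on :: "real \<Rightarrow> real \<Rightarrow> (real \<Rightarrow> 'a::real_normed_vector) \<Rightarrow> bool" where
  "absolutely_continuous_on a b x \<longleftrightarrow>
     (\<forall>e>0. \<exists>d>0. \<forall>p :: (real \<times> real) set.
        finite p \<and> (\<forall>(l, r)\<in>p. a \<le> l \<and> l \<le> r \<and> r \<le> b) \<and>
        pairwise (\<lambda>I J. {fst I<..<snd I} \<inter> {fst J<..<snd J} = {}) p \<and>
        (\<Sum>(l, r)\<in>p. r - l) < d
        \<longrightarrow> (\<Sum>(l, r)\<in>p. norm (x r - x l)) < e)"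

text \<open>Piecewise polynomials on \<open>[0,1]\<close>; jumps, and arbitrary values at the breakpoints, are allowed.\<close>

definition piecewise_polynomial :: "(real \<Rightarrow> real) \<Rightarrow> bool" where
  "piecewise_polynomial \<phi> \<longleftrightarrow>
     (\<exists>(m::nat) \<sigma>. \<sigma> 0 = (0::real) \<and> \<sigma> m = 1 \<and> (\<forall>i<m. \<sigma> i < \<sigma> (Suc i)) \<and>
        (\<forall>i<m. \<exists>p. real_polynomial_function p \<and> (\<forall>\<tau>\<in>{\<sigma> i<..<\<sigma> (Suc i)}. \<phi> \<tau> = p \<tau>)))"

section \<open>Data of the optimal control problem\<close>

text \<open>Augmented states are triples \<open>(x, y, t)\<close>. The grid points are indexed by a finite linearly
  ordered type \<open>'N\<close>, whose elements in increasing order play the role of \<open>1, \<dots>, N\<close>. The control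
  coefficient vector \<open>U\<close> is kept in its blocks \<open>U $ j\<close>, each in \<open>\<real>\<close> to the power \<open>n\<^sub>u\<close>, so that
  applying \<open>\<Gamma>\<^sub>u(\<tau>) \<otimes> I\<close> to it is the linear combination of the blocks with the
  coefficients \<open>\<Gamma>\<^sub>u(\<tau>)\<close>.\<close>

type_synonym 'nx aug = "(real^'nx) \<times> real \<times> real"

type_synonym ('nx, 'nu, 'Nu, 'Ns, 'N) dvar = "(('nx aug)^'N) \<times> ((real^'nu)^'Nu) \<times> (real^'Ns)"

text \<open>The vector-valued maps \<open>g, h, P, Q\<close> are given by their components, numbered from \<open>0\<close>;
  the number of components may be \<open>0\<close>.\<close>

record ('nx, 'nu, 'Nu, 'Ns, 'N) ocp =
  dyn :: "real \<Rightarrow> real^'nx \<Rightarrow> real^'nu \<Rightarrow> real^'nx"                          (* f *)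
  n_ineq :: nat
  path_ineq :: "nat \<Rightarrow> real \<Rightarrow> real^'nx \<Rightarrow> real^'nu \<Rightarrow> real"              (* g *)
  n_eq :: nat
  path_eq :: "nat \<Rightarrow> real \<Rightarrow> real^'nx \<Rightarrow> real^'nu \<Rightarrow> real"                (* h *)
  cost :: "real \<Rightarrow> real^'nx \<Rightarrow> real"                                         (* L *)
  n_bineq :: nat
  bnd_ineq :: "nat \<Rightarrow> real \<Rightarrow> real^'nx \<Rightarrow> real \<Rightarrow> real^'nx \<Rightarrow> real"     (* P *)
  n_beq :: nat
  bnd_eq :: "nat \<Rightarrow> real \<Rightarrow> real^'nx \<Rightarrow> real \<Rightarrow> real^'nx \<Rightarrow> real"       (* Q *)
  t_init :: real
  tol :: real                                                                  (* epsilon *)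
  pen_ineq :: "nat \<Rightarrow> real \<Rightarrow> real"                                          (* q *)
  pen_eq :: "nat \<Rightarrow> real \<Rightarrow> real"                                            (* p *)
  basis_u :: "real \<Rightarrow> real^'Nu"                                              (* Gamma_u *)
  basis_s :: "real \<Rightarrow> real^'Ns"                                              (* Gamma_s *)
  grid :: "'N \<Rightarrow> real"                                                       (* tau_k *)
  Uset :: "((real^'nu)^'Nu) set"
  Sset :: "(real^'Ns) set"

definition first_ix :: "'N::{finite,linorder}" where "first_ix = Min UNIV"

definition last_ix :: "'N::{finite,linorder}" where "last_ix = Max UNIV"

definition next_ix :: "'N::{finite,linorder} \<Rightarrow> 'N" where "next_ix k = Min {k<..}"

definition ocp_assumptions ::
    "('nx::finite, 'nu::finite, 'Nu::finite, 'Ns::finite, 'N::{finite,linorder}) ocp \<Rightarrow> bool" where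
  "ocp_assumptions d \<longleftrightarrow>
     C1_on (\<lambda>(t, x, u). dyn d t x u) ({0..} \<times> UNIV \<times> UNIV) \<and>
     (\<forall>i<n_ineq d. C1_on (\<lambda>(t, x, u). path_ineq d i t x u) ({0..} \<times> UNIV \<times> UNIV)) \<and>
     (\<forall>j<n_eq d. C1_on (\<lambda>(t, x, u). path_eq d j t x u) ({0..} \<times> UNIV \<times> UNIV)) \<and>
     C1_on (\<lambda>(t, x). cost d t x) ({0..} \<times> UNIV) \<and>
     (\<forall>i<n_bineq d. C1_on (\<lambda>(t, x, t', x'). bnd_ineq d i t x t' x')
                       ({0..} \<times> UNIV \<times> {0..} \<times> UNIV)) \<and>
     (\<forall>i<n_beq d. C1_on (\<lambda>(t, x, t', x'). bnd_eq d i t x t' x')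
                       ({0..} \<times> UNIV \<times> {0..} \<times> UNIV)) \<and>
     0 \<le> t_init d \<and> 0 < tol d \<and>
     (\<forall>K t\<^sub>f. compact K \<and> t_init d < t\<^sub>f \<longrightarrow>
        (\<exists>\<theta>>0. \<exists>\<rho>>0. \<forall>t\<in>{t_init d..t\<^sub>f}. \<forall>x. \<forall>u\<in>K. norm (dyn d t x u) \<le> \<theta> * norm x + \<rho>)) \<and>
     (\<forall>i<n_ineq d. C1_on (pen_ineq d i) UNIV \<and> (\<forall>w. 0 \<le> pen_ineq d i w) \<and>
                    (\<forall>w. pen_ineq d i w = 0 \<longleftrightarrow> w \<le> 0)) \<and>
     (\<forall>j<n_eq d. C1_on (pen_eq d j) UNIV \<and> (\<forall>w. 0 \<le> pen_eq d j w) \<and>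
                    (\<forall>w. pen_eq d j w = 0 \<longleftrightarrow> w = 0)) \<and>
     (\<forall>j. piecewise_polynomial (\<lambda>\<tau>. basis_u d \<tau> $ j)) \<and>
     (\<forall>j. piecewise_polynomial (\<lambda>\<tau>. basis_s d \<tau> $ j)) \<and>
     strict_mono (grid d) \<and> grid d first_ix = 0 \<and> grid d last_ix = 1 \<and>
     compact (Uset d) \<and> convex (Uset d) \<and>
     compact (Sset d) \<and> convex (Sset d) \<and>
     (\<forall>S\<in>Sset d. \<forall>\<tau>\<in>{0..1}. 0 < basis_s d \<tau> \<bullet> S)"

section \<open>Augmented dynamics and discretization\<close>

definition E_x :: "'nx aug \<Rightarrow> real^'nx" where "E_x X = fst X"

definition E_y :: "'nx aug \<Rightarrow> real" where "E_y X = fst (snd X)"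

definition E_t :: "'nx aug \<Rightarrow> real" where "E_t X = snd (snd X)"

definition path_penalty ::
    "('nx::finite, 'nu::finite, 'Nu::finite, 'Ns::finite, 'N) ocp \<Rightarrow> real \<Rightarrow> real^'nx \<Rightarrow> real^'nu \<Rightarrow> real" where
  "path_penalty d t x u =
     (\<Sum>i<n_ineq d. pen_ineq d i (path_ineq d i t x u)) + (\<Sum>j<n_eq d. pen_eq d j (path_eq d j t x u))"

definition aug_rhs ::
    "('nx::finite, 'nu::finite, 'Nu::finite, 'Ns::finite, 'N) ocp \<Rightarrow> 'nx aug \<Rightarrow> (real^'nu) \<times> real \<Rightarrow> 'nx aug" where
  "aug_rhs d X v = (case v of (u, s) \<Rightarrow>
     s *\<^sub>R (dyn d (E_t X) (E_x X) u, path_penalty d (E_t X) (E_x X) u, 1))"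

definition control ::
    "('nx::finite, 'nu::finite, 'Nu::finite, 'Ns::finite, 'N) ocp \<Rightarrow> (real^'nu)^'Nu \<Rightarrow> real^'Ns \<Rightarrow> real
       \<Rightarrow> (real^'nu) \<times> real" where
  "control d U S \<tau> = ((\<Sum>j\<in>UNIV. (basis_u d \<tau> $ j) *\<^sub>R (U $ j)), basis_s d \<tau> \<bullet> S)"

definition solves_aug ::
    "('nx::finite, 'nu::finite, 'Nu::finite, 'Ns::finite, 'N) ocp \<Rightarrow> real \<Rightarrow> real \<Rightarrow> 'nx aug
       \<Rightarrow> (real^'nu)^'Nu \<Rightarrow> real^'Ns \<Rightarrow> (real \<Rightarrow> 'nx aug) \<Rightarrow> bool" where
  "solves_aug d a b X0 U S x \<longleftrightarrow>
     x a = X0 \<and> absolutely_continuous_on a b x \<and>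
     (\<exists>K. negligible K \<and>
        (\<forall>\<tau>\<in>{a..b} - K.
           (x has_vector_derivative aug_rhs d (x \<tau>) (control d U S \<tau>)) (at \<tau> within {a..b})))"

definition aug_traj ::
    "('nx::finite, 'nu::finite, 'Nu::finite, 'Ns::finite, 'N::{finite,linorder}) ocp \<Rightarrow> 'N \<Rightarrow> 'nx aug
       \<Rightarrow> (real^'nu)^'Nu \<Rightarrow> real^'Ns \<Rightarrow> real \<Rightarrow> 'nx aug" where
  "aug_traj d k X0 U S = (SOME x. solves_aug d (grid d k) (grid d (next_ix k)) X0 U S x)"

definition defect ::
    "('nx::finite, 'nu::finite, 'Nu::finite, 'Ns::finite, 'N::{finite,linorder}) ocp \<Rightarrow> 'N
       \<Rightarrow> 'nx aug \<Rightarrow> 'nx aug \<Rightarrow> (real^'nu)^'Nu \<Rightarrow> real^'Ns \<Rightarrow> 'nx aug" where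
  "defect d k X' X U S =
     X' - X - integral {grid d k..grid d (next_ix k)}
                (\<lambda>\<tau>. aug_rhs d (aug_traj d k X U S \<tau>) (control d U S \<tau>))"

section \<open>The discretized problem, as functions of the decision variable\<close>

definition objective ::
    "('nx::finite, 'nu::finite, 'Nu::finite, 'Ns::finite, 'N::{finite,linorder}) ocp
       \<Rightarrow> ('nx, 'nu, 'Nu, 'Ns, 'N) dvar \<Rightarrow> real" where
  "objective d z = (case z of (X, U, S) \<Rightarrow> cost d (E_t (X $ last_ix)) (E_x (X $ last_ix)))"

definition bineq ::
    "('nx::finite, 'nu::finite, 'Nu::finite, 'Ns::finite, 'N::{finite,linorder}) ocp \<Rightarrow> nat
       \<Rightarrow> ('nx, 'nu, 'Nu, 'Ns, 'N) dvar \<Rightarrow> real" where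
  "bineq d i z = (case z of (X, U, S) \<Rightarrow>
     bnd_ineq d i (E_t (X $ first_ix)) (E_x (X $ first_ix)) (E_t (X $ last_ix)) (E_x (X $ last_ix)))"

text \<open>The component with index \<open>n_beq d\<close> is the additional one that fixes the initial time.\<close>

definition beq ::
    "('nx::finite, 'nu::finite, 'Nu::finite, 'Ns::finite, 'N::{finite,linorder}) ocp \<Rightarrow> nat
       \<Rightarrow> ('nx, 'nu, 'Nu, 'Ns, 'N) dvar \<Rightarrow> real" where
  "beq d i z = (case z of (X, U, S) \<Rightarrow>
     (if i < n_beq d
      then bnd_eq d i (t_init d) (E_x (X $ first_ix)) (E_t (X $ last_ix)) (E_x (X $ last_ix))
      else E_t (X $ first_ix) - t_init d))"

definition defect_at ::
    "('nx::finite, 'nu::finite, 'Nu::finite, 'Ns::finite, 'N::{finite,linorder}) ocp \<Rightarrow> 'N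
       \<Rightarrow> ('nx, 'nu, 'Nu, 'Ns, 'N) dvar \<Rightarrow> 'nx aug" where
  "defect_at d k z = (case z of (X, U, S) \<Rightarrow> defect d k (X $ next_ix k) (X $ k) U S)"

definition Zset ::
    "('nx::finite, 'nu::finite, 'Nu::finite, 'Ns::finite, 'N::{finite,linorder}) ocp
       \<Rightarrow> ('nx, 'nu, 'Nu, 'Ns, 'N) dvar set" where
  "Zset d = {X. \<forall>k. k \<noteq> last_ix \<longrightarrow> E_y (X $ next_ix k - X $ k) \<le> tol d} \<times> Uset d \<times> Sset d"

definition feasible ::
    "('nx::finite, 'nu::finite, 'Nu::finite, 'Ns::finite, 'N::{finite,linorder}) ocp
       \<Rightarrow> ('nx, 'nu, 'Nu, 'Ns, 'N) dvar \<Rightarrow> bool" where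
  "feasible d z \<longleftrightarrow>
     z \<in> Zset d \<and>
     (\<forall>k. k \<noteq> last_ix \<longrightarrow> defect_at d k z = 0) \<and>
     (\<forall>i<n_bineq d. bineq d i z \<le> 0) \<and>
     (\<forall>i\<le>n_beq d. beq d i z = 0)"

text \<open>The data are functions of nonnegative times only, so gradients with respect to the decision
  variable are taken relative to the following set.\<close>

definition time_dom :: "('nx::finite, 'nu::finite, 'Nu::finite, 'Ns::finite, 'N::finite) dvar set" where
  "time_dom = {(X, U, S). \<forall>k. 0 \<le> E_t (X $ k)}"

definition grad ::
    "(('nx::finite, 'nu::finite, 'Nu::finite, 'Ns::finite, 'N::finite) dvar \<Rightarrow> real)
       \<Rightarrow> ('nx, 'nu, 'Nu, 'Ns, 'N) dvar \<Rightarrow> ('nx, 'nu, 'Nu, 'Ns, 'N) dvar" where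
  "grad \<phi> z = gradient_within \<phi> time_dom z"

lemma E_t_Basis_nonneg: "b \<in> Basis \<Longrightarrow> 0 \<le> E_t (b :: ('nx::finite) aug)"
  by (auto simp: E_t_def Basis_prod_def)

lemma grad_eqI:
  fixes z v :: "('nx::finite, 'nu::finite, 'Nu::finite, 'Ns::finite, 'N::finite) dvar"
  assumes "z \<in> time_dom" "(\<phi> has_derivative (\<lambda>h. v \<bullet> h)) (at z within time_dom)"
  shows "grad \<phi> z = v"
proof -
  have "w = v" if "(\<phi> has_derivative (\<lambda>h. w \<bullet> h)) (at z within time_dom)" for w
  proof -
    have "(\<lambda>h. w \<bullet> h) = (\<lambda>h. v \<bullet> h)"
    proof (rule frechet_derivative_unique_within[OF that assms(2)])
      fix i :: "('nx, 'nu, 'Nu, 'Ns, 'N) dvar" and e :: real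
      assume i: "i \<in> Basis" and e: "0 < e"
      have "0 \<le> E_t (fst i $ k)" for k
        using i E_t_Basis_nonneg[where 'nx = 'nx]
        by (auto simp: Basis_prod_def Basis_vec_def axis_def E_t_def)
      then have "z + (e/2) *\<^sub>R i \<in> time_dom"
        using assms(1) e by (simp add: time_dom_def E_t_def case_prod_beta)
      then show "\<exists>r. 0 < \<bar>r\<bar> \<and> \<bar>r\<bar> < e \<and> z + r *\<^sub>R i \<in> time_dom"
        using e by (intro exI[of _ "e/2"]) simp
    qed
    then have "(w - v) \<bullet> (w - v) = 0"
      using fun_cong[of "(\<bullet>) w" "(\<bullet>) v" "w - v"] by (simp add: inner_diff_left)
    then show "w = v"
      by simp
  qed
  then show ?thesis
    unfolding grad_def gradient_within_def using assms(2) by (blast intro: some_equality)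
qed

section \<open>Penalized function, stationary points and KKT points\<close>

definition Theta ::
    "('nx::finite, 'nu::finite, 'Nu::finite, 'Ns::finite, 'N::{finite,linorder}) ocp \<Rightarrow> real
       \<Rightarrow> ('nx, 'nu, 'Nu, 'Ns, 'N) dvar \<Rightarrow> ereal" where
  "Theta d \<gamma> z =
     ereal (objective d z) + (if z \<in> Zset d then 0 else \<infinity>)
     + ereal (\<gamma> * (\<Sum>i<n_bineq d. pos_part (bineq d i z)))
     + ereal (\<gamma> * (\<Sum>i\<le>n_beq d. \<bar>beq d i z\<bar>))
     + ereal (\<gamma> * (\<Sum>k\<in>UNIV - {last_ix}. \<Sum>b\<in>Basis. \<bar>defect_at d k z \<bullet> b\<bar>))"

text \<open>\<open>Theta d \<gamma>\<close> is a sum of compositions of convex functions with smooth ones and is not convex;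
  its subdifferential is, by convention, the set given by the chain and sum rules.\<close>

definition Theta_subdiff ::
    "('nx::finite, 'nu::finite, 'Nu::finite, 'Ns::finite, 'N::{finite,linorder}) ocp \<Rightarrow> real
       \<Rightarrow> ('nx, 'nu, 'Nu, 'Ns, 'N) dvar \<Rightarrow> ('nx, 'nu, 'Nu, 'Ns, 'N) dvar set" where
  "Theta_subdiff d \<gamma> z =
     {grad (objective d) z + \<mu>
        + \<gamma> *\<^sub>R (\<Sum>i<n_bineq d. lP i *\<^sub>R grad (bineq d i) z)
        + \<gamma> *\<^sub>R (\<Sum>i\<le>n_beq d. lQ i *\<^sub>R grad (beq d i) z)
        + \<gamma> *\<^sub>R (\<Sum>k\<in>UNIV - {last_ix}. \<Sum>b\<in>Basis. lF k b *\<^sub>R grad (\<lambda>z. defect_at d k z \<bullet> b) z)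
      | \<mu> lP lQ lF.
        \<mu> \<in> normal_cone (Zset d) z \<and>
        (\<forall>i<n_bineq d. lP i \<in> subdifferential pos_part (bineq d i z)) \<and>
        (\<forall>i\<le>n_beq d. lQ i \<in> subdifferential abs (beq d i z)) \<and>
        (\<forall>k. k \<noteq> last_ix \<longrightarrow> (\<forall>b\<in>Basis. lF k b \<in> subdifferential abs (defect_at d k z \<bullet> b)))}"

definition stationary_point ::
    "('nx::finite, 'nu::finite, 'Nu::finite, 'Ns::finite, 'N::{finite,linorder}) ocp \<Rightarrow> real
       \<Rightarrow> ('nx, 'nu, 'Nu, 'Ns, 'N) dvar \<Rightarrow> bool" where
  "stationary_point d \<gamma> z \<longleftrightarrow> 0 \<in> Theta_subdiff d \<gamma> z"

definition KKT_point ::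
    "('nx::finite, 'nu::finite, 'Nu::finite, 'Ns::finite, 'N::{finite,linorder}) ocp
       \<Rightarrow> ('nx, 'nu, 'Nu, 'Ns, 'N) dvar \<Rightarrow> bool" where
  "KKT_point d z \<longleftrightarrow>
     feasible d z \<and>
     (\<exists>\<mu> lP lQ lF.
        \<mu> \<in> normal_cone (Zset d) z \<and>
        (\<forall>i<n_bineq d. 0 \<le> lP i) \<and>
        grad (objective d) z + \<mu>
          + (\<Sum>i<n_bineq d. lP i *\<^sub>R grad (bineq d i) z)
          + (\<Sum>i\<le>n_beq d. lQ i *\<^sub>R grad (beq d i) z)
          + (\<Sum>k\<in>UNIV - {last_ix}. \<Sum>b\<in>Basis. lF k b *\<^sub>R grad (\<lambda>z. defect_at d k z \<bullet> b) z) = 0 \<and>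
        (\<forall>i<n_bineq d. lP i * bineq d i z = 0))"

section \<open>Regularity of a constraint set at a point\<close>

definition regular_at :: "'a::euclidean_space set \<Rightarrow> 'a \<Rightarrow> bool" where
  "regular_at Z z \<longleftrightarrow>
     (\<exists>(nC::nat) (nD::nat) (\<Omega> :: nat \<Rightarrow> 'a \<Rightarrow> real) (a :: nat \<Rightarrow> 'a) (b :: nat \<Rightarrow> real) C D I.
        (\<forall>i<nC. C1_on (\<Omega> i) UNIV \<and> convex_on UNIV (\<Omega> i)) \<and>
        C = {y. \<forall>i<nC. \<Omega> i y \<le> 0} \<and>
        D = {y. \<forall>j<nD. a j \<bullet> y + b j = 0} \<and>
        Z = C \<inter> D \<and>
        I = {i. i < nC \<and> \<Omega> i z = 0} \<and>
        (\<forall>\<alpha> \<beta>. (\<Sum>i\<in>I. \<alpha> i *\<^sub>R gradient_within (\<Omega> i) UNIV z) + (\<Sum>j<nD. \<beta> j *\<^sub>R a j) = 0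
                  \<longrightarrow> (\<forall>i\<in>I. \<alpha> i = 0) \<and> (\<forall>j<nD. \<beta> j = (0::real))) \<and>
        D \<inter> interior C \<noteq> {})"

end

theory Submission
  imports Defs
begin

text \<open>
  At a feasible point all equality constraints sit at the kink of \<open>abs\<close>, where its subdifferential is
  the interval \<open>[-1, 1]\<close>, and each inequality constraint sits either at the kink of \<open>pos_part\<close>, with
  subdifferential \<open>[0, 1]\<close>, or to the left of it, with subdifferential \<open>{0}\<close>. So the subgradients of
  the penalty terms at a feasible point are exactly the sign-admissible, complementary multipliers of
  absolute value at most one (\<open>subdifferential_pos_part_feasible\<close>, \<open>subdifferential_abs_zero\<close>). The
  stationarity equation of the penalized function is the KKT equation with every multiplier written
  as \<open>\<gamma>\<close> times such a subgradient, and the normal cone term is the same in both.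

  Hence a feasible stationary point has the KKT multipliers \<open>\<gamma> \<lambda>\<close>. Conversely, dividing KKT
  multipliers by \<open>\<gamma>\<close> gives subgradients as soon as \<open>\<gamma>\<close> dominates all of them in absolute value;
  there are finitely many, so every sufficiently large \<open>\<gamma>\<close> does.
\<close>

lemma subdifferential_abs_zero: "v \<in> subdifferential abs 0 \<longleftrightarrow> \<bar>v\<bar> \<le> 1"
proof
  assume "v \<in> subdifferential abs 0"
  then have "\<bar>y\<bar> \<ge> v * y" for y
    by (simp add: subdifferential_def)
  from this[of 1] this[of "-1"] show "\<bar>v\<bar> \<le> 1"
    by simp
next
  assume v: "\<bar>v\<bar> \<le> 1"
  have "v * y \<le> \<bar>y\<bar>" for y
    using abs_ge_self[of "v * y"] mult_right_mono[OF v abs_ge_zero[of y]]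
    by (simp add: abs_mult)
  then show "v \<in> subdifferential abs 0"
    by (simp add: subdifferential_def)
qed

text \<open>Testing the subgradient inequality at \<open>w - 1\<close> gives the sign of the slope. Testing it at the
  kink \<open>0\<close>, where \<open>pos_part\<close> has the same value as at \<open>w\<close>, gives complementary slackness, and testing
  it at \<open>1\<close> then bounds the slope.\<close>

lemma subdifferential_pos_part_feasible:
  assumes "w \<le> 0"
  shows "v \<in> subdifferential pos_part w \<longleftrightarrow> 0 \<le> v \<and> v \<le> 1 \<and> v * w = 0"
proof
  assume "v \<in> subdifferential pos_part w"
  then have *: "max 0 y \<ge> v * (y - w)" for y
    using assms by (simp add: subdifferential_def pos_part_def)
  have "0 \<le> v"
    using *[of "w - 1"] assms by simp
  moreover have "v * w = 0"
    using *[of 0] \<open>0 \<le> v\<close> assms mult_nonneg_nonpos[of v w] by simp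
  moreover have "v \<le> 1"
    using *[of 1] \<open>v * w = 0\<close> by (simp add: right_diff_distrib)
  ultimately show "0 \<le> v \<and> v \<le> 1 \<and> v * w = 0"
    by blast
next
  assume v: "0 \<le> v \<and> v \<le> 1 \<and> v * w = 0"
  have "v * (y - w) \<le> max 0 y" for y
  proof -
    have "v * y \<le> max 0 y"
      using v mult_left_le_one_le[of y v] mult_nonneg_nonpos[of v y] by (cases "0 \<le> y") auto
    with v show ?thesis
      by (simp only: right_diff_distrib)
  qed
  then show "v \<in> subdifferential pos_part w"
    using assms by (simp add: subdifferential_def pos_part_def)
qed

text \<open>The constraint part of the gradient of the Lagrangian. Because it is linear in the multipliers,
  the penalty parameter can be absorbed into them.\<close>

definition multiplier_term ::
    "('nx::finite, 'nu::finite, 'Nu::finite, 'Ns::finite, 'N::{finite,linorder}) ocp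
       \<Rightarrow> ('nx, 'nu, 'Nu, 'Ns, 'N) dvar \<Rightarrow> (nat \<Rightarrow> real) \<Rightarrow> (nat \<Rightarrow> real)
       \<Rightarrow> ('N \<Rightarrow> 'nx aug \<Rightarrow> real) \<Rightarrow> ('nx, 'nu, 'Nu, 'Ns, 'N) dvar" where
  "multiplier_term d z lP lQ lF =
     (\<Sum>i<n_bineq d. lP i *\<^sub>R grad (bineq d i) z)
     + (\<Sum>i\<le>n_beq d. lQ i *\<^sub>R grad (beq d i) z)
     + (\<Sum>k\<in>UNIV - {last_ix}. \<Sum>b\<in>Basis. lF k b *\<^sub>R grad (\<lambda>z. defect_at d k z \<bullet> b) z)"

lemma scaleR_multiplier_term:
  "\<gamma> *\<^sub>R multiplier_term d z lP lQ lF =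
     multiplier_term d z (\<lambda>i. \<gamma> * lP i) (\<lambda>i. \<gamma> * lQ i) (\<lambda>k b. \<gamma> * lF k b)"
  by (simp add: multiplier_term_def scaleR_add_right scaleR_sum_right)

lemma KKT_point_iff:
  "KKT_point d z \<longleftrightarrow>
     feasible d z \<and>
     (\<exists>\<mu> lP lQ lF. \<mu> \<in> normal_cone (Zset d) z \<and>
        (\<forall>i<n_bineq d. 0 \<le> lP i) \<and>
        grad (objective d) z + \<mu> + multiplier_term d z lP lQ lF = 0 \<and>
        (\<forall>i<n_bineq d. lP i * bineq d i z = 0))"
  unfolding KKT_point_def multiplier_term_def add.assoc ..

text \<open>Feasibility turns the subgradient conditions into conditions on multipliers, which brings
  stationarity into the form of the KKT conditions.\<close>

lemma stationary_point_iff_of_feasible: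
  fixes d :: "('nx::finite, 'nu::finite, 'Nu::finite, 'Ns::finite, 'N::{finite,linorder}) ocp"
  assumes "feasible d z"
  shows "stationary_point d \<gamma> z \<longleftrightarrow>
     (\<exists>\<mu> lP lQ lF.
        0 = grad (objective d) z + \<mu> + \<gamma> *\<^sub>R multiplier_term d z lP lQ lF \<and>
        \<mu> \<in> normal_cone (Zset d) z \<and>
        (\<forall>i<n_bineq d. 0 \<le> lP i \<and> lP i \<le> 1 \<and> lP i * bineq d i z = 0) \<and>
        (\<forall>i\<le>n_beq d. \<bar>lQ i\<bar> \<le> 1) \<and>
        (\<forall>k. k \<noteq> last_ix \<longrightarrow> (\<forall>b\<in>Basis. \<bar>lF k b\<bar> \<le> 1)))"
proof -
  have P: "(\<forall>i<n_bineq d. lP i \<in> subdifferential pos_part (bineq d i z)) \<longleftrightarrow>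
      (\<forall>i<n_bineq d. 0 \<le> lP i \<and> lP i \<le> 1 \<and> lP i * bineq d i z = 0)" for lP
    using assms by (auto simp: feasible_def subdifferential_pos_part_feasible)
  have Q: "(\<forall>i\<le>n_beq d. lQ i \<in> subdifferential abs (beq d i z)) \<longleftrightarrow>
      (\<forall>i\<le>n_beq d. \<bar>lQ i\<bar> \<le> 1)" for lQ
    using assms by (auto simp: feasible_def subdifferential_abs_zero)
  have F: "(\<forall>k. k \<noteq> last_ix \<longrightarrow> (\<forall>b\<in>Basis. lF k b \<in> subdifferential abs (defect_at d k z \<bullet> b))) \<longleftrightarrow>
      (\<forall>k. k \<noteq> last_ix \<longrightarrow> (\<forall>b\<in>Basis. \<bar>lF k b\<bar> \<le> 1))" for lF
    using assms by (auto simp: feasible_def subdifferential_abs_zero)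
  show ?thesis
    unfolding stationary_point_def Theta_subdiff_def mem_Collect_eq P Q F
      multiplier_term_def scaleR_add_right add.assoc ..
qed

lemma finite_eventually_bounds_abs:
  fixes A :: "real set"
  assumes "finite A"
  shows "\<exists>\<gamma>\<^sub>0>0. \<forall>\<gamma>\<ge>\<gamma>\<^sub>0. \<forall>a\<in>A. \<bar>a\<bar> \<le> \<gamma>"
proof -
  obtain B where "0 < B" "\<forall>a\<in>A. \<bar>a\<bar> \<le> B"
    using finite_imp_bounded[OF assms] unfolding bounded_pos by auto
  then show ?thesis
    by (meson order_trans)
qed

theorem theorem19:
  fixes d :: "('nx::finite, 'nu::finite, 'Nu::finite, 'Ns::finite, 'N::{finite,linorder}) ocp"
    and z :: "('nx, 'nu, 'Nu, 'Ns, 'N) dvar"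
  assumes "ocp_assumptions d"
    and "regular_at (Zset d) z"
  shows "(\<forall>\<gamma>>0. stationary_point d \<gamma> z \<and> feasible d z \<longrightarrow> KKT_point d z) \<and>
         (KKT_point d z \<longrightarrow> (\<exists>\<gamma>\<^sub>0>0. \<forall>\<gamma>\<ge>\<gamma>\<^sub>0. stationary_point d \<gamma> z))"
proof (intro conjI allI impI)
  fix \<gamma> :: real
  assume \<gamma>: "0 < \<gamma>" and "stationary_point d \<gamma> z \<and> feasible d z"
  then have feas: "feasible d z" and stat: "stationary_point d \<gamma> z"
    by auto
  from stat obtain \<mu> lP lQ lF
    where eq: "0 = grad (objective d) z + \<mu> + \<gamma> *\<^sub>R multiplier_term d z lP lQ lF"
      and \<mu>: "\<mu> \<in> normal_cone (Zset d) z"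
      and lP: "\<forall>i<n_bineq d. 0 \<le> lP i \<and> lP i \<le> 1 \<and> lP i * bineq d i z = 0"
    unfolding stationary_point_iff_of_feasible[OF feas] by (elim exE conjE) rule
  show "KKT_point d z"
    unfolding KKT_point_iff
  proof (intro conjI exI)
    show "grad (objective d) z + \<mu>
        + multiplier_term d z (\<lambda>i. \<gamma> * lP i) (\<lambda>i. \<gamma> * lQ i) (\<lambda>k b. \<gamma> * lF k b) = 0"
      using eq by (simp add: scaleR_multiplier_term)
  qed (use \<gamma> lP feas \<mu> in auto)
next
  assume "KKT_point d z"
  then obtain \<mu> lP lQ lF where feas: "feasible d z" and \<mu>: "\<mu> \<in> normal_cone (Zset d) z"
    and lP: "\<forall>i<n_bineq d. 0 \<le> lP i"
    and eq: "grad (objective d) z + \<mu> + multiplier_term d z lP lQ lF = 0"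
    and slack: "\<forall>i<n_bineq d. lP i * bineq d i z = 0"
    unfolding KKT_point_iff by (elim exE conjE) rule
  define A where "A = lP ` {..<n_bineq d} \<union> lQ ` {..n_beq d} \<union> case_prod lF ` (UNIV \<times> Basis)"
  have "finite A"
    by (simp add: A_def)
  then obtain \<gamma>\<^sub>0 where \<gamma>\<^sub>0: "0 < \<gamma>\<^sub>0" and bound: "\<And>\<gamma> a. \<gamma>\<^sub>0 \<le> \<gamma> \<Longrightarrow> a \<in> A \<Longrightarrow> \<bar>a\<bar> \<le> \<gamma>"
    using finite_eventually_bounds_abs by meson
  have "stationary_point d \<gamma> z" if "\<gamma>\<^sub>0 \<le> \<gamma>" for \<gamma>
  proof -
    have pos: "0 < \<gamma>"
      using \<gamma>\<^sub>0 that by simp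
    have unit: "\<bar>a / \<gamma>\<bar> \<le> 1" if "a \<in> A" for a
      using bound[OF \<open>\<gamma>\<^sub>0 \<le> \<gamma>\<close> that] pos by (simp add: abs_divide)
    show ?thesis
      unfolding stationary_point_iff_of_feasible[OF feas]
    proof (intro exI conjI)
      show "0 = grad (objective d) z + \<mu>
          + \<gamma> *\<^sub>R multiplier_term d z (\<lambda>i. lP i / \<gamma>) (\<lambda>i. lQ i / \<gamma>) (\<lambda>k b. lF k b / \<gamma>)"
        using eq pos by (simp add: scaleR_multiplier_term)
      show "\<mu> \<in> normal_cone (Zset d) z"
        by (rule \<mu>)
      show "\<forall>i<n_bineq d. 0 \<le> lP i / \<gamma> \<and> lP i / \<gamma> \<le> 1 \<and> lP i / \<gamma> * bineq d i z = 0"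
      proof (intro allI impI)
        fix i
        assume i: "i < n_bineq d"
        then have "\<bar>lP i / \<gamma>\<bar> \<le> 1"
          by (intro unit) (simp add: A_def)
        then show "0 \<le> lP i / \<gamma> \<and> lP i / \<gamma> \<le> 1 \<and> lP i / \<gamma> * bineq d i z = 0"
          using lP slack i pos by auto
      qed
      show "\<forall>i\<le>n_beq d. \<bar>lQ i / \<gamma>\<bar> \<le> 1"
        by (intro allI impI unit) (simp add: A_def)
      show "\<forall>k. k \<noteq> last_ix \<longrightarrow> (\<forall>b\<in>Basis. \<bar>lF k b / \<gamma>\<bar> \<le> 1)"
        by (intro allI impI ballI unit) (force simp: A_def)
    qed
  qed
  with \<gamma>\<^sub>0 show "\<exists>\<gamma>\<^sub>0>0. \<forall>\<gamma>\<ge>\<gamma>\<^sub>0. stationary_point d \<gamma> z"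
    by blast
qed

end
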